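(* Let $\mathfrak B\leq_G\mathfrak B'$ be flags of bases of the uniform flag matroid $\mathfrak U_n=(U_{0,n},\dots,U_{n,n})$, with Gale permutations $\pi_{\mathfrak B}\leq_G\pi_{\mathfrak B'}$ and Bruhat permutations $\tau_{\mathfrak B}\geq_B\tau_{\mathfrak B'}$. The following are equivalent: (i) the order-interval $[\mathfrak B,\mathfrak B']_G$ constitutes the set of flags of bases of a (full) lattice path flag matroid on $[n]$; (ii) for all $1\leq k\leq n$ the maps $\mathrm{st}_{\pi_{\mathfrak B}([k])}:\pi_{\mathfrak B}([k])\to[k]$ and $\mathrm{st}_{\pi_{\mathfrak B'}([k])}:\pi_{\mathfrak B'}([k])\to[k]$ satisfy $$\max\{0,\ \pi_{\mathfrak B}(k)-\pi_{\mathfrak B'}(k)\}\leq \mathrm{st}_{\pi_{\mathfrak B}([k])}(\pi_{\mathfrak B}(k))-\mathrm{st}_{\pi_{\mathfrak B'}([k])}(\pi_{\mathfrak B'}(k));$$ (iii) for every $1\leq k\leq n$, setting $a_k=\tau_{\mathfrak B}^{-1}(n-k+1)$ and $a'_k=\tau_{\mathfrak B'}^{-1}(n-k+1)$, one has $$\max\{0,\ a_k-a'_k\}\leq \mathrm{st}_{\{a_1,\dots,a_k\}}(a_k)-\mathrm{st}_{\{a'_1,\dots,a'_k\}}(a'_k).$$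
   Context: $[n]=\{1,\dots,n\}$; $U_{k,n}$ is the uniform matroid of rank $k$ on $[n]$. For $A=\{a_1<\dots<a_k\}$, $B=\{b_1<\dots<b_k\}$ in $\binom{[n]}{k}$, $A\leq_G B$ (Gale order) iff $a_i\leq b_i$ for all $i$. A flag of bases of $\mathfrak U_n$ is a chain $\mathfrak B=(B_0\subseteq B_1\subseteq\dots\subseteq B_n)$ with $B_i\in\binom{[n]}{i}$; $\mathfrak B\leq_G\mathfrak B'$ iff $B_i\leq_G B_i'$ for all $i$, and $[\mathfrak B,\mathfrak B']_G$ is the set of flags $\mathfrak C$ of bases of $\mathfrak U_n$ with $\mathfrak B\leq_G\mathfrak C\leq_G\mathfrak B'$. The Gale permutation $\pi=\pi_{\mathfrak B}\in S_n$ is given by $\{\pi(i)\}=B_i\setminus B_{i-1}$. The Bruhat permutation is $\tau_{\mathfrak B}=\overline\pi^{-1}$ where $\overline\pi(i)=\pi(n-i+1)$. By definition $\pi_{\mathfrak B}\leq_G\pi_{\mathfrak B'}$ iff $\mathfrak B\leq_G\mathfrak B'$; this is equivalent to $\tau_{\mathfrak B}\geq_B\tau_{\mathfrak B'}$ in the strong Bruhat order $\leq_B$ of $S_n$. For $\pi\in S_n$, $\pi([k])=\{\pi(1),\dots,\pi(k)\}$. For a set $S$ of $m$ positive integers, the standardization map $\mathrm{st}_S:S\to[m]$ is the unique order-preserving bijection. For $U\leq_G L$ in $\binom{[n]}{k}$, the lattice path matroid (LPM) $M[U,L]$ is the matroid on $[n]$ with set of bases $\{B\in\binom{[n]}{k}: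 U\leq_G B\leq_G L\}$. For matroids $M,M'$ on $[n]$ with sets of bases $\mathcal B,\mathcal B'$, $M'\leq_Q M$ ($M'$ is a quotient of $M$) if for all $B\in\mathcal B$ and $p\in[n]\setminus B$ there is $B'\in\mathcal B'$ with $B'\subseteq B$ such that for all $q\in B'$: if $(B'\cup\{p\})\setminus\{q\}\in\mathcal B'$ then $(B\cup\{p\})\setminus\{q\}\in\mathcal B$. A (full) lattice path flag matroid (LPFM) on $[n]$ is a sequence $(M_0,\dots,M_n)$ of distinct LPMs on $[n]$ with $M_i\leq_Q M_{i+1}$ for $0\leq i\leq n-1$ (so $M_i$ has rank $i$); its flags of bases are the chains $B_0\subseteq\dots\subseteq B_n$ with $B_i$ a basis of $M_i$. *)

theory Defs
  imports "HOL-Library.FuncSet" "HOL-Combinatorics.Permutations"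
begin

definition gale_le :: "nat set \<Rightarrow> nat set \<Rightarrow> bool" where
  "gale_le A B \<longleftrightarrow> list_all2 (\<le>) (sorted_list_of_set A) (sorted_list_of_set B)"

lemma gale_le_imp_card_eq: "gale_le A B \<Longrightarrow> card A = card B"
  unfolding gale_le_def by (metis list_all2_lengthD length_sorted_list_of_set)

lemma card_Int_atMost_sorted_list:
  fixes A :: "nat set"
  assumes "finite A"
  shows "card (A \<inter> {..j}) = card {i. i < card A \<and> sorted_list_of_set A ! i \<le> j}"
proof -
  let ?as = "sorted_list_of_set A"
  have "A \<inter> {..j} = (!) ?as ` {i. i < card A \<and> ?as ! i \<le> j}"
  proof -
    have "A = set ?as" using assms by simp
    then have "A = (!) ?as ` {i. i < card A}"
      unfolding set_conv_nth using assms by auto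
    then show ?thesis by auto
  qed
  moreover have "inj_on ((!) ?as) {i. i < card A \<and> ?as ! i \<le> j}"
    by (rule inj_on_nth) auto
  ultimately show ?thesis by (simp add: card_image)
qed

lemma gale_le_iff_card_Int:
  assumes "finite A" "finite B"
  shows "gale_le A B \<longleftrightarrow> card A = card B \<and> (\<forall>j. card (B \<inter> {..j}) \<le> card (A \<inter> {..j}))"
proof
  assume g: "gale_le A B"
  have c: "card A = card B" using g by (rule gale_le_imp_card_eq)
  have le: "sorted_list_of_set A ! i \<le> sorted_list_of_set B ! i" if "i < card A" for i
    using g that unfolding gale_le_def list_all2_conv_all_nth by simp
  show "card A = card B \<and> (\<forall>j. card (B \<inter> {..j}) \<le> card (A \<inter> {..j}))"
  proof (intro conjI allI c)
    fix j
    have "{i. i < card B \<and> sorted_list_of_set B ! i \<le> j}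
        \<subseteq> {i. i < card A \<and> sorted_list_of_set A ! i \<le> j}"
      using le c by (auto intro: order_trans)
    then show "card (B \<inter> {..j}) \<le> card (A \<inter> {..j})"
      unfolding card_Int_atMost_sorted_list[OF assms(1)] card_Int_atMost_sorted_list[OF assms(2)]
      by (intro card_mono) auto
  qed
next
  assume h: "card A = card B \<and> (\<forall>j. card (B \<inter> {..j}) \<le> card (A \<inter> {..j}))"
  let ?as = "sorted_list_of_set A" and ?bs = "sorted_list_of_set B"
  have "?as ! i \<le> ?bs ! i" if i: "i < card A" for i
  proof (rule ccontr)
    assume n: "\<not> ?as ! i \<le> ?bs ! i"
    let ?j = "?bs ! i"
    have "{..i} \<subseteq> {i'. i' < card B \<and> ?bs ! i' \<le> ?j}"
      using i h by (auto intro!: sorted_nth_mono)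
    then have "card {..i} \<le> card (B \<inter> {..?j})"
      unfolding card_Int_atMost_sorted_list[OF assms(2)] by (intro card_mono) auto
    also have "\<dots> \<le> card (A \<inter> {..?j})" using h by blast
    also have "{i'. i' < card A \<and> ?as ! i' \<le> ?j} \<subseteq> {..<i}"
    proof
      fix i' assume i': "i' \<in> {i'. i' < card A \<and> ?as ! i' \<le> ?j}"
      show "i' \<in> {..<i}"
      proof (rule ccontr)
        assume "i' \<notin> {..<i}"
        then have "?as ! i \<le> ?as ! i'" using i' by (intro sorted_nth_mono) auto
        then show False using n i' by auto
      qed
    qed
    then have "card (A \<inter> {..?j}) \<le> card {..<i}"
      unfolding card_Int_atMost_sorted_list[OF assms(1)] by (intro card_mono) auto
    finally show False by simp
  qed
  then show "gale_le A B"
    unfolding gale_le_def list_all2_conv_all_nth using h by simp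
qed

text \<open>A matroid is represented by its ground set together with its set of bases.\<close>

definition matroid_bases :: "'a set \<Rightarrow> 'a set set \<Rightarrow> bool" where
  "matroid_bases E \<B> \<longleftrightarrow> finite E \<and> \<B> \<noteq> {} \<and> \<B> \<subseteq> Pow E \<and>
     (\<forall>A\<in>\<B>. \<forall>B\<in>\<B>. \<forall>x\<in>A - B. \<exists>y\<in>B - A. insert y (A - {x}) \<in> \<B>)"

definition matroid_quotient :: "'a set \<Rightarrow> 'a set set \<Rightarrow> 'a set set \<Rightarrow> bool" where
  "matroid_quotient E \<B>' \<B> \<longleftrightarrow> matroid_bases E \<B>' \<and> matroid_bases E \<B> \<and>
     (\<forall>B\<in>\<B>. \<forall>p\<in>E - B. \<exists>B'\<in>\<B>'. B' \<subseteq> B \<and>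
        (\<forall>q\<in>B'. (B' \<union> {p}) - {q} \<in> \<B>' \<longrightarrow> (B \<union> {p}) - {q} \<in> \<B>))"

definition ksubsets :: "nat \<Rightarrow> nat \<Rightarrow> nat set set" where
  "ksubsets n k = {B. B \<subseteq> {1..n} \<and> card B = k}"

lemma ksubsetsD:
  assumes "B \<in> ksubsets n k"
  shows "finite B" "B \<subseteq> {1..n}" "card B = k"
  using assms finite_subset[of B "{1..n}"] by (auto simp: ksubsets_def)

definition uniform_matroid :: "nat \<Rightarrow> nat \<Rightarrow> nat set set" where
  "uniform_matroid n k = ksubsets n k"

definition lpm :: "nat \<Rightarrow> nat \<Rightarrow> nat set \<Rightarrow> nat set \<Rightarrow> nat set set" where
  "lpm n k U L = {B \<in> ksubsets n k. gale_le U B \<and> gale_le B L}"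

definition is_lpm :: "nat \<Rightarrow> nat set set \<Rightarrow> bool" where
  "is_lpm n M \<longleftrightarrow> (\<exists>k. \<exists>U\<in>ksubsets n k. \<exists>L\<in>ksubsets n k. gale_le U L \<and> M = lpm n k U L)"

lemma card_Int_atMost_exchange:
  fixes A :: "nat set"
  assumes "finite A" "x \<in> A" "y \<notin> A"
  shows "card (insert y (A - {x}) \<inter> {..j}) + (if x \<le> j then 1 else 0)
       = card (A \<inter> {..j}) + (if y \<le> j then 1 else 0)"
proof -
  have fin: "finite (A \<inter> {..j} - {x})" using assms by simp
  have 1: "card (A \<inter> {..j}) = card (A \<inter> {..j} - {x}) + (if x \<le> j then 1 else 0)"
  proof (cases "x \<le> j")
    case True
    then show ?thesis using assms card.remove[of "A \<inter> {..j}" x] by simp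
  next
    case False
    then have "A \<inter> {..j} - {x} = A \<inter> {..j}" by auto
    then show ?thesis using False by simp
  qed
  have 2: "insert y (A - {x}) \<inter> {..j}
      = (if y \<le> j then insert y (A \<inter> {..j} - {x}) else A \<inter> {..j} - {x})" by auto
  have "card (insert y (A - {x}) \<inter> {..j}) = card (A \<inter> {..j} - {x}) + (if y \<le> j then 1 else 0)"
    unfolding 2 using fin assms by auto
  with 1 show ?thesis by simp
qed

lemma card_Int_atMost_split:
  fixes A :: "nat set"
  assumes "finite A" "i \<le> j"
  shows "card (A \<inter> {..j}) = card (A \<inter> {..i}) + card (A \<inter> {i<..j})"
proof -
  have "A \<inter> {..j} = (A \<inter> {..i}) \<union> (A \<inter> {i<..j})" using assms(2) by auto
  then show ?thesis using assms(1) by (simp add: card_Un_disjoint disjoint_iff)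
qed

lemma lpm_exchange:
  assumes A: "A \<in> lpm n k U L" and B: "B \<in> lpm n k U L" and x: "x \<in> A - B"
    and fin: "finite U" "finite L"
  shows "\<exists>y\<in>B - A. insert y (A - {x}) \<in> lpm n k U L"
proof -
  have fA: "finite A" "A \<subseteq> {1..n}" "card A = k" and fB: "finite B" "B \<subseteq> {1..n}" "card B = k"
    using A B ksubsetsD[of A n k] ksubsetsD[of B n k] by (simp_all add: lpm_def)
  have UA: "card (A \<inter> {..j}) \<le> card (U \<inter> {..j})" and LA: "card (L \<inter> {..j}) \<le> card (A \<inter> {..j})"
    and UB: "card (B \<inter> {..j}) \<le> card (U \<inter> {..j})" and LB: "card (L \<inter> {..j}) \<le> card (B \<inter> {..j})" for j
    using A B fA fB fin by (auto simp: lpm_def gale_le_iff_card_Int)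
  have cUL: "card U = k" "card L = k"
    using A fA gale_le_imp_card_eq by (auto simp: lpm_def)
  have inI: "insert y (A - {x}) \<in> lpm n k U L"
    if y: "y \<in> B - A"
      and up: "\<And>j. y \<le> j \<Longrightarrow> j < x \<Longrightarrow> card (A \<inter> {..j}) < card (B \<inter> {..j})"
      and down: "\<And>j. x \<le> j \<Longrightarrow> j < y \<Longrightarrow> card (B \<inter> {..j}) < card (A \<inter> {..j})" for y
  proof -
    let ?C = "insert y (A - {x})"
    have "0 < k" using fA x by (metis DiffD1 card_gt_0_iff empty_iff)
    then have cC: "card ?C = k" using y fA x by simp
    have "card (?C \<inter> {..j}) \<le> card (U \<inter> {..j}) \<and> card (L \<inter> {..j}) \<le> card (?C \<inter> {..j})" for j
    proof -
      have "card (?C \<inter> {..j}) + (if x \<le> j then 1 else 0)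
          = card (A \<inter> {..j}) + (if y \<le> j then 1 else 0)"
        using fA(1) x y by (intro card_Int_atMost_exchange) auto
      then show ?thesis
        using UA[of j] LA[of j] UB[of j] LB[of j] up[of j] down[of j]
        by (cases "x \<le> j"; cases "y \<le> j"; simp; linarith)
    qed
    moreover have "?C \<subseteq> {1..n}" "finite ?C" using fA fB y by auto
    ultimately show ?thesis
      using cC cUL fin by (auto simp: lpm_def ksubsets_def gale_le_iff_card_Int)
  qed
  show ?thesis
  proof (cases "card (B \<inter> {..x}) < card (A \<inter> {..x})")
    case True
    have key: "card (B \<inter> {..j}) < card (A \<inter> {..j})"
      if "x \<le> j" "\<And>y. y \<in> B - A \<Longrightarrow> x < y \<Longrightarrow> j < y" for j
    proof -
      have "B \<inter> {x<..j} \<subseteq> A \<inter> {x<..j}" using that(2) by force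
      then have "card (B \<inter> {x<..j}) \<le> card (A \<inter> {x<..j})" by (intro card_mono) auto
      then show ?thesis using True that(1) fA fB
        by (simp add: card_Int_atMost_split[of _ x j])
    qed
    let ?Y = "{y \<in> B - A. x < y}"
    have fY: "finite ?Y" using fB by simp
    have nY: "?Y \<noteq> {}"
    proof
      assume "?Y = {}"
      moreover have "x \<le> n" using fA x by auto
      ultimately have "card (B \<inter> {..n}) < card (A \<inter> {..n})" by (intro key) blast+
      moreover have "B \<inter> {..n} = B" "A \<inter> {..n} = A" using fA fB by auto
      ultimately show False using fA fB by simp
    qed
    have m: "Min ?Y \<in> ?Y" using fY nY by (rule Min_in)
    have "card (B \<inter> {..j}) < card (A \<inter> {..j})" if "x \<le> j" "j < Min ?Y" for j
      using that fY nY by (intro key) auto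
    then have "insert (Min ?Y) (A - {x}) \<in> lpm n k U L" using m by (intro inI) auto
    then show ?thesis using m by blast
  next
    case False
    have key: "card (A \<inter> {..j}) < card (B \<inter> {..j})"
      if "j < x" "\<And>y. y \<in> B - A \<Longrightarrow> y < x \<Longrightarrow> y \<le> j" for j
    proof -
      have "B \<inter> {j<..x} \<subset> A \<inter> {j<..x}"
      proof
        show "B \<inter> {j<..x} \<subseteq> A \<inter> {j<..x}"
        proof
          fix z assume z: "z \<in> B \<inter> {j<..x}"
          then have "z < x" using x by (cases "z = x") auto
          then show "z \<in> A \<inter> {j<..x}" using that(2)[of z] z by (cases "z \<in> A") auto
        qed
        have "x \<in> A \<inter> {j<..x}" "x \<notin> B \<inter> {j<..x}" using x that(1) by auto
        then show "B \<inter> {j<..x} \<noteq> A \<inter> {j<..x}" by metis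
      qed
      then have "card (B \<inter> {j<..x}) < card (A \<inter> {j<..x})" by (intro psubset_card_mono) auto
      then show ?thesis using False that(1) fA fB
        by (simp add: card_Int_atMost_split[of _ j x])
    qed
    let ?Y = "{y \<in> B - A. y < x}"
    have fY: "finite ?Y" using fB by simp
    have nY: "?Y \<noteq> {}"
    proof
      assume "?Y = {}"
      moreover have "0 < x" using fA x by auto
      ultimately have "card (A \<inter> {..0}) < card (B \<inter> {..0})" by (intro key) blast+
      moreover have "B \<inter> {..0} = {}" using fB by auto
      ultimately show False by simp
    qed
    have m: "Max ?Y \<in> ?Y" using fY nY by (rule Max_in)
    have "card (A \<inter> {..j}) < card (B \<inter> {..j})" if "Max ?Y \<le> j" "j < x" for j
      using that fY nY by (intro key) auto
    then have "insert (Max ?Y) (A - {x}) \<in> lpm n k U L" using m by (intro inI) auto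
    then show ?thesis using m by blast
  qed
qed

lemma is_lpm_imp_matroid_bases:
  assumes "is_lpm n M"
  shows "matroid_bases {1..n} M"
proof -
  obtain k U L where UL: "U \<in> ksubsets n k" "L \<in> ksubsets n k" "gale_le U L"
    and M: "M = lpm n k U L" using assms unfolding is_lpm_def by blast
  have fin: "finite U" "finite L" using UL ksubsetsD(1) by blast+
  have "U \<in> M" unfolding M using UL fin by (auto simp: lpm_def gale_le_iff_card_Int)
  moreover have "M \<subseteq> Pow {1..n}" unfolding M by (auto simp: lpm_def ksubsets_def)
  ultimately show ?thesis
    unfolding matroid_bases_def M
  proof (intro conjI ballI)
    fix A B x
    assume "A \<in> lpm n k U L" "B \<in> lpm n k U L" "x \<in> A - B"
    then show "\<exists>y\<in>B - A. insert y (A - {x}) \<in> lpm n k U L" using fin by (rule lpm_exchange)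
  qed auto
qed

text \<open>Flags are functions on \<open>{0..n}\<close>, made \<^const>\<open>undefined\<close> outside \<open>{0..n}\<close> so that equality of
  sets of flags means what it should.\<close>

definition flags_of_bases :: "nat \<Rightarrow> (nat \<Rightarrow> nat set set) \<Rightarrow> (nat \<Rightarrow> nat set) set" where
  "flags_of_bases n M = {B \<in> Pi\<^sub>E {0..n} M. \<forall>i<n. B i \<subseteq> B (Suc i)}"

definition uniform_flags :: "nat \<Rightarrow> (nat \<Rightarrow> nat set) set" where
  "uniform_flags n = flags_of_bases n (uniform_matroid n)"

definition flag_gale_le :: "nat \<Rightarrow> (nat \<Rightarrow> nat set) \<Rightarrow> (nat \<Rightarrow> nat set) \<Rightarrow> bool" where
  "flag_gale_le n B B' \<longleftrightarrow> (\<forall>i\<in>{0..n}. gale_le (B i) (B' i))"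

definition flag_gale_interval ::
    "nat \<Rightarrow> (nat \<Rightarrow> nat set) \<Rightarrow> (nat \<Rightarrow> nat set) \<Rightarrow> (nat \<Rightarrow> nat set) set" where
  "flag_gale_interval n B B' = {C \<in> uniform_flags n. flag_gale_le n B C \<and> flag_gale_le n C B'}"

text \<open>That \<open>M i\<close> has rank \<open>i\<close> is a consequence: a proper quotient has smaller rank.\<close>

definition is_lpfm :: "nat \<Rightarrow> (nat \<Rightarrow> nat set set) \<Rightarrow> bool" where
  "is_lpfm n M \<longleftrightarrow> (\<forall>i\<in>{0..n}. is_lpm n (M i)) \<and> inj_on M {0..n} \<and>
     (\<forall>i<n. matroid_quotient {1..n} (M i) (M (Suc i)))"

text \<open>Elements of \<open>S\<^sub>n\<close> are functions \<open>p\<close> with \<^term>\<open>p permutes {1..n}\<close>, that is, extended by the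
  identity; so \<^const>\<open>inv\<close> is inversion in \<open>S\<^sub>n\<close>.\<close>

definition gale_perm :: "nat \<Rightarrow> (nat \<Rightarrow> nat set) \<Rightarrow> nat \<Rightarrow> nat" where
  "gale_perm n B i = (if i \<in> {1..n} then the_elem (B i - B (i - 1)) else i)"

definition bruhat_perm :: "nat \<Rightarrow> (nat \<Rightarrow> nat set) \<Rightarrow> nat \<Rightarrow> nat" where
  "bruhat_perm n B = inv (\<lambda>i. if i \<in> {1..n} then gale_perm n B (n - i + 1) else i)"

definition standardization :: "nat set \<Rightarrow> nat \<Rightarrow> nat" where
  "standardization S =
     (THE f. f \<in> extensional S \<and> bij_betw f S {1..card S} \<and> mono_on S f)"

lemma order_bijection_eq_card:
  fixes S :: "nat set"
  assumes "bij_betw f S {1..card S}" "mono_on S f" "x \<in> S"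
  shows "f x = card {y \<in> S. y \<le> x}"
proof -
  have inj: "inj_on f S" and im: "f ` S = {1..card S}"
    using assms(1) by (auto simp: bij_betw_def)
  have le: "f y \<le> f x \<longleftrightarrow> y \<le> x" if "y \<in> S" for y
    using that assms(2,3) inj by (metis inj_onD mono_onD nle_le)
  have "f ` {y \<in> S. y \<le> x} = {z \<in> f ` S. z \<le> f x}" using le by auto
  also have "\<dots> = {1..f x}"
  proof -
    have "f x \<in> f ` S" using assms(3) by (rule imageI)
    then show ?thesis unfolding im by auto
  qed
  finally have "card (f ` {y \<in> S. y \<le> x}) = f x" by simp
  moreover have "inj_on f {y \<in> S. y \<le> x}" using inj by (rule inj_on_subset) auto
  ultimately show ?thesis using card_image by metis
qed

lemma ex1_order_bijection:
  fixes S :: "nat set"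
  assumes "finite S"
  shows "\<exists>!f. f \<in> extensional S \<and> bij_betw f S {1..card S} \<and> mono_on S f"
proof (rule ex_ex1I)
  define g where "g = restrict (\<lambda>x. card {y \<in> S. y \<le> x}) S"
  have strict: "g x < g y" if "x \<in> S" "y \<in> S" "x < y" for x y
  proof -
    have "{z \<in> S. z \<le> x} \<subset> {z \<in> S. z \<le> y}" using that by force
    then have "card {z \<in> S. z \<le> x} < card {z \<in> S. z \<le> y}"
      using assms by (intro psubset_card_mono) auto
    then show ?thesis using that by (simp add: g_def)
  qed
  have inj: "inj_on g S"
    by (rule linorder_inj_onI) (use strict in fastforce)+
  have "g ` S \<subseteq> {1..card S}"
  proof
    fix z assume "z \<in> g ` S"
    then obtain x where x: "x \<in> S" "z = card {y \<in> S. y \<le> x}"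
      by (auto simp: g_def)
    have "card {x} \<le> z" unfolding x(2) using assms x(1) by (intro card_mono) auto
    moreover have "z \<le> card S" unfolding x(2) using assms by (intro card_mono) auto
    ultimately show "z \<in> {1..card S}" by simp
  qed
  then have "g ` S = {1..card S}" using inj by (intro card_subset_eq) (auto simp: card_image)
  with inj have "bij_betw g S {1..card S}" unfolding bij_betw_def by blast
  moreover have "mono_on S g"
    by (rule mono_onI) (use strict in \<open>fastforce simp: le_less\<close>)
  ultimately show "\<exists>f. f \<in> extensional S \<and> bij_betw f S {1..card S} \<and> mono_on S f"
    by (intro exI[of _ g]) (simp add: g_def)
next
  fix f g :: "nat \<Rightarrow> nat"
  assume f: "f \<in> extensional S \<and> bij_betw f S {1..card S} \<and> mono_on S f"
    and g: "g \<in> extensional S \<and> bij_betw g S {1..card S} \<and> mono_on S g"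
  show "f = g"
  proof (rule extensionalityI[of _ S])
    fix x assume x: "x \<in> S"
    have "f x = card {y \<in> S. y \<le> x}" using f x by (intro order_bijection_eq_card) auto
    moreover have "g x = card {y \<in> S. y \<le> x}" using g x by (intro order_bijection_eq_card) auto
    ultimately show "f x = g x" by simp
  qed (use f g in auto)
qed

lemma standardization_eq_card:
  assumes "finite S" "x \<in> S"
  shows "standardization S x = card {y \<in> S. y \<le> x}"
  using theI'[OF ex1_order_bijection[OF assms(1)]] order_bijection_eq_card assms(2)
  unfolding standardization_def by blast

lemma gale_perm_singleton:
  assumes B: "B \<in> uniform_flags n" and i: "i \<in> {1..n}"
  shows "B i - B (i - 1) = {gale_perm n B i}"
proof -
  obtain m where m: "i = Suc m" "m < n" using i by (cases i) auto
  have "B m \<in> ksubsets n m" "B (Suc m) \<in> ksubsets n (Suc m)" "B m \<subseteq> B (Suc m)"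
    using B m by (auto simp: uniform_flags_def flags_of_bases_def uniform_matroid_def PiE_iff)
  then have "card (B (Suc m) - B m) = 1"
    using ksubsetsD[of "B m" n m] ksubsetsD[of "B (Suc m)" n "Suc m"] by (simp add: card_Diff_subset)
  then obtain x where "B (Suc m) - B m = {x}" by (auto simp: card_1_singleton_iff)
  then show ?thesis using i m by (simp add: gale_perm_def)
qed

lemma gale_perm_image:
  assumes B: "B \<in> uniform_flags n"
  shows "k \<le> n \<Longrightarrow> gale_perm n B ` {1..k} = B k"
proof (induction k)
  case 0
  have "B 0 \<in> ksubsets n 0"
    using B by (auto simp: uniform_flags_def flags_of_bases_def uniform_matroid_def PiE_iff)
  then have "B 0 = {}" using ksubsetsD[of "B 0" n 0] by simp
  then show ?case by simp
next
  case (Suc k)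
  have "B k \<subseteq> B (Suc k)" using B Suc.prems by (auto simp: uniform_flags_def flags_of_bases_def)
  moreover have "B (Suc k) - B k = {gale_perm n B (Suc k)}"
    using gale_perm_singleton[OF B, of "Suc k"] Suc.prems by simp
  moreover have "{1..Suc k} = insert (Suc k) {1..k}" by auto
  ultimately show ?case using Suc by auto
qed

lemma gale_perm_permutes:
  assumes B: "B \<in> uniform_flags n"
  shows "gale_perm n B permutes {1..n}"
proof (rule bij_imp_permutes)
  have "B n \<in> ksubsets n n"
    using B by (auto simp: uniform_flags_def flags_of_bases_def uniform_matroid_def PiE_iff)
  then have "B n = {1..n}" by (intro card_subset_eq) (auto simp: ksubsets_def)
  then have im: "gale_perm n B ` {1..n} = {1..n}" using gale_perm_image[OF B, of n] by simp
  then have "inj_on (gale_perm n B) {1..n}" by (intro eq_card_imp_inj_on) auto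
  with im show "bij_betw (gale_perm n B) {1..n} {1..n}" unfolding bij_betw_def by blast
qed (unfold gale_perm_def, rule if_not_P)

end

theory Submission
  imports Defs
begin

text \<open>
  A \<open>k\<close>-subset \<open>A\<close> of \<open>{1..n}\<close> is viewed as a lattice path: step \<open>j\<close> goes north if \<open>j \<in> A\<close> and
  east otherwise. After \<open>j\<close> steps the path is at height \<open>card (A \<inter> {..j})\<close> and has made
  \<open>j - card (A \<inter> {..j})\<close> east steps. The bases of the lattice path matroid \<open>M[U,L]\<close> are the paths
  with the same endpoints as \<open>U\<close> and \<open>L\<close> that stay below \<open>U\<close> and above \<open>L\<close>
  (\<open>mem_lpm_iff\<close>), and whether a swap in a basis yields a basis depends on whether its path
  touches \<open>L\<close> or \<open>U\<close> on the stretch between the two elements (\<open>lpm_swap_iff\<close>).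

  Condition (i) splits into one condition for each rank. The flags of bases of
  \<open>M[B\<^sub>i, B'\<^sub>i]\<close>, \<open>0 \<le> i \<le> n\<close>, are by definition the interval between \<open>B\<close> and \<open>B'\<close>.
  Conversely, every basis of a constituent of a flag matroid lies in a flag of bases
  (\<open>basis_in_flag\<close>), so a lattice path flag matroid whose flags form this interval can only have
  the constituents \<open>M[B\<^sub>i, B'\<^sub>i]\<close> (\<open>interval_lpfm_constituents\<close>). Hence (i) says that each of these
  matroids is a quotient of the next one.

  Let the north step \<open>u\<close> be removed from \<open>U\<close> and \<open>l\<close> from \<open>L\<close>. The matroid of the shortened paths
  is a quotient of \<open>M[U,L]\<close> if and only if the step \<open>u\<close> of \<open>U\<close> ends at least as high as the step
  \<open>l\<close> of \<open>L\<close>, and at most as far east. If so, then for a basis \<open>B\<close> and \<open>p \<notin> B\<close> the element to be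
  removed from \<open>B\<close> has to lie behind some touching points of \<open>B\<close> with \<open>U\<close> and \<open>L\<close> and not behind
  some others, and the two inequalities say that every point of the first kind is lower on \<open>B\<close> than
  every point of the second kind (\<open>quotient_step_sufficient\<close>). If an inequality fails, then a
  path that follows one boundary, crosses straight to the other and follows that one violates the
  quotient condition (\<open>quotient_step_height\<close>, \<open>quotient_step_width\<close>).

  Since standardization is rank within the set, these inequalities are the two halves of the
  \<open>max\<close> in (ii). Finally, \<open>a k = \<pi> k\<close> on \<open>{1..n}\<close>, so (iii) is (ii) in the language of Bruhat
  permutations.
\<close>

section \<open>Subsets as lattice paths\<close>

abbreviation prefix_count :: "nat set \<Rightarrow> nat \<Rightarrow> nat" where
  "prefix_count A j \<equiv> card (A \<inter> {..j})"

lemma prefix_count_remove: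
  assumes "finite A" "x \<in> A"
  shows "prefix_count (A - {x}) j + (if x \<le> j then 1 else 0) = prefix_count A j"
proof (cases "x \<le> j")
  case True
  have "(A - {x}) \<inter> {..j} = A \<inter> {..j} - {x}" by auto
  then show ?thesis using assms True card.remove[of "A \<inter> {..j}" x] by simp
next
  case False
  then have "(A - {x}) \<inter> {..j} = A \<inter> {..j}" by auto
  then show ?thesis using False by simp
qed

lemma prefix_count_mono:
  assumes "finite A" "i \<le> j"
  shows "prefix_count A i \<le> prefix_count A j"
  using assms by (intro card_mono) auto

lemma prefix_count_strict_mono:
  assumes "finite A" "i < x" "x \<in> A"
  shows "prefix_count A i < prefix_count A x"
proof (rule psubset_card_mono)
  have "x \<in> A \<inter> {..x}" "x \<notin> A \<inter> {..i}" using assms by auto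
  then show "A \<inter> {..i} \<subset> A \<inter> {..x}" using assms(2) by force
qed (use assms in simp)

lemma prefix_count_Suc:
  "prefix_count A (Suc j) = prefix_count A j + (if Suc j \<in> A then 1 else 0)"
  by (simp add: atMost_Suc Int_insert_right)

lemma prefix_count_diff_le:
  "i \<le> j \<Longrightarrow> prefix_count A j \<le> prefix_count A i + (j - i)"
proof (induction j)
  case (Suc j)
  then show ?case by (cases "i = Suc j") (auto simp: prefix_count_Suc)
qed simp

text \<open>An east step at \<open>p\<close> is what makes the bound on the height gained strict.\<close>

lemma prefix_count_diff_less:
  assumes "i < p" "p \<le> j" "p \<notin> A"
  shows "prefix_count A j < prefix_count A i + (j - i)"
proof -
  obtain m where m: "p = Suc m" using assms(1) by (cases p) auto
  have "prefix_count A j \<le> prefix_count A p + (j - p)"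
    using assms(2) by (rule prefix_count_diff_le)
  moreover have "prefix_count A p = prefix_count A m" using m assms(3) by (simp add: prefix_count_Suc)
  moreover have "prefix_count A m \<le> prefix_count A i + (m - i)"
    using assms(1) m by (intro prefix_count_diff_le) simp
  ultimately show ?thesis using assms m by linarith
qed

section \<open>Lattice path matroids\<close>

lemma mem_lpm_iff:
  assumes "U \<in> ksubsets n k" "L \<in> ksubsets n k" "B \<in> ksubsets n k"
  shows "B \<in> lpm n k U L \<longleftrightarrow>
    (\<forall>j. prefix_count L j \<le> prefix_count B j \<and> prefix_count B j \<le> prefix_count U j)"
proof -
  note U = ksubsetsD[OF assms(1)] and L = ksubsetsD[OF assms(2)] and B = ksubsetsD[OF assms(3)]
  show ?thesis
    using assms(3) U(3) L(3) B(3)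
    unfolding lpm_def mem_Collect_eq gale_le_iff_card_Int[OF U(1) B(1)]
      gale_le_iff_card_Int[OF B(1) L(1)] by metis
qed

text \<open>
  Exchanging \<open>q\<close> for \<open>p\<close> lowers the path of \<open>B\<close> by one on \<open>{q..<p}\<close> or raises it by one on
  \<open>{p..<q}\<close>; the result stays in the region exactly if the path is not tight there. This describes
  the fundamental circuit of \<open>p\<close>.
\<close>

lemma lpm_swap_iff:
  assumes U: "U \<in> ksubsets n k" and L: "L \<in> ksubsets n k" and B: "B \<in> lpm n k U L"
    and p: "p \<in> {1..n} - B" and q: "q \<in> B"
  shows "(B \<union> {p}) - {q} \<in> lpm n k U L \<longleftrightarrow>
    (\<forall>j. q \<le> j \<and> j < p \<longrightarrow> prefix_count L j < prefix_count B j) \<and>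
    (\<forall>j. p \<le> j \<and> j < q \<longrightarrow> prefix_count B j < prefix_count U j)"
proof -
  let ?C = "insert p (B - {q})"
  have Bk: "B \<in> ksubsets n k" using B by (simp add: lpm_def)
  note fB = ksubsetsD[OF Bk]
  have bnd: "prefix_count L j \<le> prefix_count B j" "prefix_count B j \<le> prefix_count U j" for j
    using B mem_lpm_iff[OF U L Bk] by auto
  have ne: "p \<noteq> q" using p q by auto
  then have eq: "(B \<union> {p}) - {q} = ?C" by auto
  have "0 < k" using fB q by (metis card_gt_0_iff empty_iff)
  then have Ck: "?C \<in> ksubsets n k" using fB p q by (auto simp: ksubsets_def)
  have cnt: "prefix_count ?C j + (if q \<le> j then 1 else 0)
      = prefix_count B j + (if p \<le> j then 1 else 0)" for j
    using fB p q by (intro card_Int_atMost_exchange) auto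
  have "(prefix_count L j \<le> prefix_count ?C j \<and> prefix_count ?C j \<le> prefix_count U j) \<longleftrightarrow>
      (q \<le> j \<and> j < p \<longrightarrow> prefix_count L j < prefix_count B j) \<and>
      (p \<le> j \<and> j < q \<longrightarrow> prefix_count B j < prefix_count U j)" for j
    using cnt[of j] bnd[of j] by (cases "q \<le> j"; cases "p \<le> j") auto
  then show ?thesis unfolding eq mem_lpm_iff[OF U L Ck] by blast
qed

lemma ksubsets_remove:
  "U \<in> ksubsets n (Suc k) \<Longrightarrow> u \<in> U \<Longrightarrow> U - {u} \<in> ksubsets n k"
  unfolding ksubsets_def by (auto simp: card_Diff_singleton)

lemma mem_is_lpm:
  "U \<in> ksubsets n k \<Longrightarrow> L \<in> ksubsets n k \<Longrightarrow> gale_le U L \<Longrightarrow> is_lpm n (lpm n k U L)"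
  unfolding is_lpm_def by blast

lemma ksubset_subset_remove:
  assumes "B \<in> ksubsets n (Suc k)" "B' \<in> ksubsets n k" "B' \<subseteq> B"
  obtains b where "b \<in> B" "B' = B - {b}"
proof -
  have "card (B - B') = 1"
    using assms ksubsetsD[of B n "Suc k"] ksubsetsD[of B' n k] by (simp add: card_Diff_subset)
  then obtain b where "B - B' = {b}" by (auto simp: card_1_singleton_iff)
  then show thesis using assms(3) by (intro that[of b]) auto
qed

section \<open>Bases of a quotient and flags of bases\<close>

lemma quotient_basis_below:
  assumes Q: "matroid_quotient E \<B>' \<B>" and B: "B \<in> \<B>"
  shows "\<exists>B'\<in>\<B>'. B' \<subseteq> B"
proof (cases "E - B = {}")
  case True
  have "\<B>' \<noteq> {}" "\<B>' \<subseteq> Pow E" using Q by (auto simp: matroid_quotient_def matroid_bases_def)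
  then show ?thesis using True by blast
next
  case False
  then show ?thesis using Q B unfolding matroid_quotient_def by blast
qed

text \<open>
  In this form of the exchange axiom the added element is prescribed and not the removed one. Among
  the bases that contain \<open>x\<close> and \<open>A \<inter> B\<close>, one that has most elements in common with \<open>A\<close> must lie
  in \<open>insert x A\<close>, since any other element could be exchanged for one of \<open>A\<close>. By equicardinality
  it is \<open>A\<close> with one element replaced by \<open>x\<close>.
\<close>

lemma matroid_dual_exchange:
  assumes M: "matroid_bases E \<B>" and A: "A \<in> \<B>" and B: "B \<in> \<B>" and x: "x \<in> B - A"
    and card: "\<And>D. D \<in> \<B> \<Longrightarrow> card D = k"
  shows "\<exists>y\<in>A - B. (A \<union> {x}) - {y} \<in> \<B>"
proof -
  have fin: "finite D" if "D \<in> \<B>" for D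
    using M that finite_subset[of D E] unfolding matroid_bases_def by blast
  define P where "P D \<longleftrightarrow> D \<in> \<B> \<and> insert x (A \<inter> B) \<subseteq> D" for D
  have "P B" using B x by (auto simp: P_def)
  moreover have "card (D \<inter> A) \<le> card A" for D using fin[OF A] by (intro card_mono) auto
  ultimately have "\<exists>D. P D \<and> (\<forall>C. P C \<longrightarrow> card (C \<inter> A) \<le> card (D \<inter> A))"
    by (intro ex_has_greatest_nat[where b = "Suc (card A)"]) (auto simp: less_Suc_eq_le)
  then obtain D where D: "P D" and max: "\<And>C. P C \<Longrightarrow> card (C \<inter> A) \<le> card (D \<inter> A)"
    by blast
  have sub: "D \<subseteq> insert x A"
  proof
    fix z assume z: "z \<in> D"
    show "z \<in> insert x A"
    proof (rule ccontr)
      assume nz: "z \<notin> insert x A"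
      have "D \<in> \<B>" "z \<in> D - A" using D z nz by (auto simp: P_def)
      moreover have "\<forall>D\<in>\<B>. \<forall>C\<in>\<B>. \<forall>z\<in>D - C. \<exists>y\<in>C - D. insert y (D - {z}) \<in> \<B>"
        using M by (simp add: matroid_bases_def)
      ultimately have "\<exists>y\<in>A - D. insert y (D - {z}) \<in> \<B>" using A by simp
      then obtain y where y: "y \<in> A - D" "insert y (D - {z}) \<in> \<B>" by blast
      have "P (insert y (D - {z}))" using y D nz by (auto simp: P_def)
      moreover have "insert y (D - {z}) \<inter> A = insert y (D \<inter> A)" using y nz by auto
      ultimately have "card (insert y (D \<inter> A)) \<le> card (D \<inter> A)" using max by metis
      then show False using y fin[OF A] by simp
    qed
  qed
  have "card (insert x A - D) = card (insert x A) - card D"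
    using sub fin D by (intro card_Diff_subset) (auto simp: P_def)
  also have "\<dots> = 1" using x fin A D card by (simp add: P_def)
  finally obtain y where y: "insert x A - D = {y}" by (auto simp: card_1_singleton_iff)
  then have "D = (A \<union> {x}) - {y}" using sub by auto
  moreover have "y \<in> A - B" using y D by (auto simp: P_def)
  ultimately show ?thesis using D by (auto simp: P_def)
qed

text \<open>
  A basis \<open>B\<close> that contains as much of \<open>B'\<close> as possible contains all of it: for \<open>p \<in> B' - B\<close>, the
  quotient condition transfers to \<open>B\<close> an exchange that brings in \<open>p\<close> and removes an element
  outside of \<open>B'\<close>.
\<close>

lemma quotient_basis_above:
  assumes Q: "matroid_quotient E \<B>' \<B>" and B': "B' \<in> \<B>'"
    and card: "\<And>D. D \<in> \<B>' \<Longrightarrow> card D = k"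
  shows "\<exists>B\<in>\<B>. B' \<subseteq> B"
proof -
  have M': "matroid_bases E \<B>'" and M: "matroid_bases E \<B>"
    using Q by (auto simp: matroid_quotient_def)
  have fB': "finite B'" "B' \<subseteq> E"
    using M' B' finite_subset[of B' E] unfolding matroid_bases_def by blast+
  obtain B0 where "B0 \<in> \<B>" using M unfolding matroid_bases_def by blast
  moreover have "card (D \<inter> B') \<le> card B'" for D using fB' by (intro card_mono) auto
  ultimately have "\<exists>B. B \<in> \<B> \<and> (\<forall>C. C \<in> \<B> \<longrightarrow> card (C \<inter> B') \<le> card (B \<inter> B'))"
    by (intro ex_has_greatest_nat[where b = "Suc (card B')"]) (auto simp: less_Suc_eq_le)
  then obtain B where B: "B \<in> \<B>"
    and max: "\<And>C. C \<in> \<B> \<Longrightarrow> card (C \<inter> B') \<le> card (B \<inter> B')" by blast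
  have "B' \<subseteq> B"
  proof (rule ccontr)
    assume "\<not> B' \<subseteq> B"
    then obtain p where p: "p \<in> B'" "p \<notin> B" by blast
    then have "p \<in> E - B" using fB' by blast
    then have "\<exists>A\<in>\<B>'. A \<subseteq> B \<and> (\<forall>q\<in>A. (A \<union> {p}) - {q} \<in> \<B>' \<longrightarrow> (B \<union> {p}) - {q} \<in> \<B>)"
      using Q B unfolding matroid_quotient_def by simp
    then obtain A where A: "A \<in> \<B>'" "A \<subseteq> B"
      and ex: "\<And>q. q \<in> A \<Longrightarrow> (A \<union> {p}) - {q} \<in> \<B>' \<Longrightarrow> (B \<union> {p}) - {q} \<in> \<B>"
      by blast
    obtain q where q: "q \<in> A - B'" "(A \<union> {p}) - {q} \<in> \<B>'"
      using matroid_dual_exchange[OF M' A(1) B' _ card, of p] p A by blast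
    have "((B \<union> {p}) - {q}) \<inter> B' = insert p (B \<inter> B')" using p q by auto
    then have "card (insert p (B \<inter> B')) \<le> card (B \<inter> B')" using max[OF ex[of q]] q by auto
    then show False using p fB' by simp
  qed
  then show ?thesis using B by blast
qed

text \<open>
  A flag through \<open>A\<close> is built in both directions from rank \<open>i\<close>, by extending bases upwards and
  thinning them out downwards.
\<close>

lemma basis_in_flag:
  assumes rank: "\<And>j. j \<le> n \<Longrightarrow> M j \<subseteq> ksubsets n j"
    and Q: "\<And>j. j < n \<Longrightarrow> matroid_quotient {1..n} (M j) (M (Suc j))"
    and i: "i \<le> n" and A: "A \<in> M i"
  shows "\<exists>C\<in>flags_of_bases n M. C i = A"
proof -
  have "\<exists>f. \<forall>m. (f m \<in> {X. (m = 0 \<longrightarrow> X = A) \<and> (i + m \<le> n \<longrightarrow> X \<in> M (i + m))}) \<and>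
      (i + m < n \<longrightarrow> f m \<subseteq> f (Suc m))"
  proof (rule dependent_nat_choice, goal_cases)
    case (2 X m)
    show ?case
    proof (cases "i + m < n")
      case True
      have "card D = i + m" if "D \<in> M (i + m)" for D
        using rank[of "i + m"] that True ksubsetsD(3) by auto
      then show ?thesis
        using quotient_basis_above[OF Q[OF True], of X "i + m"] 2 True by auto
    qed auto
  qed (use A in auto)
  then obtain f where f: "f 0 = A" "\<And>m. i + m \<le> n \<Longrightarrow> f m \<in> M (i + m)"
    "\<And>m. i + m < n \<Longrightarrow> f m \<subseteq> f (Suc m)" by auto
  have "\<exists>g. \<forall>m. (g m \<in> {X. (m = 0 \<longrightarrow> X = A) \<and> (m \<le> i \<longrightarrow> X \<in> M (i - m))}) \<and>
      (m < i \<longrightarrow> g (Suc m) \<subseteq> g m)"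
  proof (rule dependent_nat_choice, goal_cases)
    case (2 X m)
    show ?case
    proof (cases "m < i")
      case True
      then have "Suc (i - Suc m) = i - m" by simp
      then show ?thesis
        using quotient_basis_below[OF Q[of "i - Suc m"], of X] 2 True i by (auto simp: Bex_def)
    qed auto
  qed (use A in auto)
  then obtain g where g: "g 0 = A" "\<And>m. m \<le> i \<Longrightarrow> g m \<in> M (i - m)"
    "\<And>m. m < i \<Longrightarrow> g (Suc m) \<subseteq> g m" by auto
  define C where "C = restrict (\<lambda>j. if i \<le> j then f (j - i) else g (i - j)) {0..n}"
  have "C j \<in> M j" if "j \<le> n" for j
    using f(2)[of "j - i"] g(2)[of "i - j"] that by (auto simp: C_def)
  moreover have "C j \<subseteq> C (Suc j)" if "j < n" for j
  proof -
    consider "i \<le> j" | "Suc j = i" | "Suc j < i" by linarith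
    then show ?thesis
    proof cases
      case 1
      then show ?thesis using f(3)[of "j - i"] that by (simp add: C_def Suc_diff_le)
    next
      case 2
      then show ?thesis using g(3)[of 0] g(1) f(1) that by (auto simp: C_def)
    next
      case 3
      then have "Suc (i - Suc j) = i - j" by simp
      then show ?thesis using g(3)[of "i - Suc j"] that 3 by (auto simp: C_def)
    qed
  qed
  ultimately have "C \<in> flags_of_bases n M"
    by (auto simp: flags_of_bases_def C_def PiE_iff)
  moreover have "C i = A" using i f(1) by (simp add: C_def)
  ultimately show ?thesis by blast
qed

section \<open>When removing one step from each boundary yields a quotient\<close>

text \<open>
  The subset of \<open>B\<close> required by the quotient condition is \<open>B - {b}\<close> for a suitable \<open>b\<close>. At \<open>j\<close>, the
  removal changes the distance of the path to \<open>U\<close> by \<open>[b \<le> j] - [u \<le> j]\<close> and the distance to \<open>L\<close>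
  by \<open>[l \<le> j] - [b \<le> j]\<close>. So \<open>B - {b}\<close> leaves the region where \<open>B\<close> touches \<open>U\<close> at some \<open>j\<close> with
  \<open>u \<le> j < b\<close> or touches \<open>L\<close> at some \<open>j\<close> with \<open>b \<le> j < l\<close>. The circuit of \<open>p\<close> can only grow where
  a touching point is lost: with \<open>U\<close>, to the right of \<open>p\<close>, at \<open>b \<le> j < u\<close>, and with \<open>L\<close>, to the
  left of \<open>p\<close>, at \<open>l \<le> j < b\<close>. Thus \<open>b\<close> must come after the points of a set \<open>X\<close> and not after those
  of a set \<open>Y\<close>, and such an element of \<open>B\<close> exists if \<open>B\<close> is lower at each point of \<open>X\<close> than at each
  point of \<open>Y\<close>.
\<close>

lemma quotient_step_sufficient:
  assumes U: "U \<in> ksubsets n (Suc k)" and L: "L \<in> ksubsets n (Suc k)" and UL: "gale_le U L"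
    and u: "u \<in> U" and l: "l \<in> L" and UL': "gale_le (U - {u}) (L - {l})"
    and height: "prefix_count L l \<le> prefix_count U u"
    and width: "u + prefix_count L l \<le> l + prefix_count U u"
  shows "matroid_quotient {1..n} (lpm n k (U - {u}) (L - {l})) (lpm n (Suc k) U L)"
proof -
  note U' = ksubsets_remove[OF U u] and L' = ksubsets_remove[OF L l]
  note fU = ksubsetsD[OF U] and fL = ksubsetsD[OF L]
  show ?thesis
    unfolding matroid_quotient_def
  proof (intro conjI ballI)
    fix B p assume B: "B \<in> lpm n (Suc k) U L" and p: "p \<in> {1..n} - B"
    have Bk: "B \<in> ksubsets n (Suc k)" using B by (simp add: lpm_def)
    note fB = ksubsetsD[OF Bk]
    have bnd: "prefix_count L j \<le> prefix_count B j" "prefix_count B j \<le> prefix_count U j" for j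
      using B mem_lpm_iff[OF U L Bk] by auto
    define X where "X = {j. j < l \<and> prefix_count B j = prefix_count L j} \<union>
      {j. p \<le> j \<and> j < u \<and> prefix_count B j = prefix_count U j}"
    define Y where "Y = {j. u \<le> j \<and> j \<le> n \<and> prefix_count B j = prefix_count U j} \<union>
      {j. l \<le> j \<and> j < p \<and> prefix_count B j = prefix_count L j}"
    have finX: "finite X" by (rule finite_subset[of _ "{..max l u}"]) (auto simp: X_def)
    have finY: "finite Y" by (rule finite_subset[of _ "{..max n p}"]) (auto simp: Y_def)
    \<comment> \<open>Both sets are nonempty because all paths share their endpoints.\<close>
    have ends: "prefix_count A 0 = 0" "prefix_count A n = card A" if "A \<subseteq> {1..n}" for A
    proof -
      have "A \<inter> {..0} = {}" "A \<inter> {..n} = A" using that by auto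
      then show "prefix_count A 0 = 0" "prefix_count A n = card A" by simp_all
    qed
    have "0 < l" "u \<le> n" using fL(2) l fU(2) u by auto
    then have "0 \<in> X" "n \<in> Y"
      using ends[OF fL(2)] ends[OF fB(2)] ends[OF fU(2)] fB(3) fU(3) by (simp_all add: X_def Y_def)
    have sep: "prefix_count B x < prefix_count B y" if x: "x \<in> X" and y: "y \<in> Y" for x y
    proof -
      consider (a) "x < l" "prefix_count B x = prefix_count L x"
        | (b) "p \<le> x" "x < u" "prefix_count B x = prefix_count U x" using x by (auto simp: X_def)
      then show ?thesis
      proof cases
        case a
        have "prefix_count L x < prefix_count L l"
          using prefix_count_strict_mono fL(1) a(1) l by blast
        moreover have "prefix_count L l \<le> prefix_count B y"
          using y height prefix_count_mono[OF fU(1), of u y] prefix_count_mono[OF fL(1), of l y]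
          by (auto simp: Y_def)
        ultimately show ?thesis using a by simp
      next
        case b
        have xu: "prefix_count U x < prefix_count U u"
          using prefix_count_strict_mono fU(1) b(2) u by blast
        show ?thesis
        proof (cases "u \<le> y \<and> prefix_count B y = prefix_count U y")
          case True
          then show ?thesis using b xu prefix_count_mono[OF fU(1), of u y] by simp
        next
          case False
          \<comment> \<open>\<open>B\<close> would touch \<open>L\<close> at \<open>y\<close>, at least as far east as the step \<open>l\<close>, and make the east step \<open>p\<close> before it
            touches \<open>U\<close> at \<open>x\<close>, not farther east than the step \<open>u\<close>.\<close>
          then have y: "l \<le> y" "y < p" "prefix_count B y = prefix_count L y"
            using y by (auto simp: Y_def)
          have "prefix_count B x < prefix_count B y + (x - y)"
            using p y b by (intro prefix_count_diff_less) auto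
          moreover have "prefix_count L y \<le> prefix_count L l + (y - l)"
            using y(1) by (rule prefix_count_diff_le)
          moreover have "prefix_count U u \<le> prefix_count U x + (u - x)"
            using b(2) by (intro prefix_count_diff_le) simp
          ultimately have False using width b y by linarith
          then show ?thesis ..
        qed
      qed
    qed
    have MX: "Max X \<in> X" using finX \<open>0 \<in> X\<close> by (intro Max_in) auto
    have MY: "Min Y \<in> Y" using finY \<open>n \<in> Y\<close> by (intro Min_in) auto
    have "\<not> B \<inter> {..Min Y} \<subseteq> B \<inter> {..Max X}"
      using sep[OF MX MY] fB(1) card_mono[of "B \<inter> {..Max X}" "B \<inter> {..Min Y}"] by auto
    then have "\<exists>b\<in>B. Max X < b \<and> b \<le> Min Y" by (auto simp: subset_iff not_le)
    then obtain b where b: "b \<in> B" "Max X < b" "b \<le> Min Y" by blast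
    have bX: "x < b" if "x \<in> X" for x using Max_ge[OF finX that] b by simp
    have bY: "b \<le> y" if "y \<in> Y" for y using Min_le[OF finY that] b by simp
    let ?B' = "B - {b}"
    have B'k: "?B' \<in> ksubsets n k" using Bk b(1) by (rule ksubsets_remove)
    note rB = prefix_count_remove[OF fB(1) b(1)] and rU = prefix_count_remove[OF fU(1) u]
      and rL = prefix_count_remove[OF fL(1) l]
    have "b \<le> n" using b fB by auto
    have B': "?B' \<in> lpm n k (U - {u}) (L - {l})"
      unfolding mem_lpm_iff[OF U' L' B'k]
    proof (intro allI conjI)
      fix j
      have "prefix_count L j < prefix_count B j" if "b \<le> j" "j < l"
        using bX[of j] bnd[of j] that by (force simp: X_def)
      then show "prefix_count (L - {l}) j \<le> prefix_count ?B' j"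
        using rB[of j] rL[of j] bnd[of j] by (cases "b \<le> j"; cases "l \<le> j") auto
      have "prefix_count B j < prefix_count U j" if "u \<le> j" "j < b"
        using bY[of j] bnd[of j] that \<open>b \<le> n\<close> by (force simp: Y_def)
      then show "prefix_count ?B' j \<le> prefix_count (U - {u}) j"
        using rB[of j] rU[of j] bnd[of j] by (cases "b \<le> j"; cases "u \<le> j") auto
    qed
    have "(B \<union> {p}) - {q} \<in> lpm n (Suc k) U L"
      if q: "q \<in> ?B'" and C: "(?B' \<union> {p}) - {q} \<in> lpm n k (U - {u}) (L - {l})" for q
    proof -
      have p': "p \<in> {1..n} - ?B'" using p by auto
      note C' = C[unfolded lpm_swap_iff[OF U' L' B' p' q]]
      have qB: "q \<in> B" using q by simp
      show ?thesis
        unfolding lpm_swap_iff[OF U L B p qB]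
      proof (intro conjI allI impI)
        fix j assume j: "q \<le> j \<and> j < p"
        then have "prefix_count (L - {l}) j < prefix_count ?B' j" using C' by blast
        moreover have "b \<le> j" if "l \<le> j" "prefix_count B j = prefix_count L j"
          using bY[of j] that j by (auto simp: Y_def)
        ultimately show "prefix_count L j < prefix_count B j"
          using rB[of j] rL[of j] bnd[of j] by (cases "b \<le> j"; cases "l \<le> j") force+
      next
        fix j assume j: "p \<le> j \<and> j < q"
        then have "prefix_count ?B' j < prefix_count (U - {u}) j" using C' by blast
        moreover have "j < b" if "j < u" "prefix_count B j = prefix_count U j"
          using bX[of j] that j by (auto simp: X_def)
        ultimately show "prefix_count B j < prefix_count U j"
          using rB[of j] rU[of j] bnd[of j] by (cases "b \<le> j"; cases "u \<le> j") force+
      qed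
    qed
    then show "\<exists>B'\<in>lpm n k (U - {u}) (L - {l}). B' \<subseteq> B \<and>
        (\<forall>q\<in>B'. (B' \<union> {p}) - {q} \<in> lpm n k (U - {u}) (L - {l}) \<longrightarrow>
          (B \<union> {p}) - {q} \<in> lpm n (Suc k) U L)"
      using B' by blast
  qed (use U L UL U' L' UL' mem_is_lpm is_lpm_imp_matroid_bases in blast)+
qed

text \<open>
  If \<open>U\<close> is lower after its step \<open>u\<close> than \<open>L\<close> after its step \<open>l\<close>, follow \<open>U\<close> to the end of \<open>u\<close>, go
  east until \<open>L\<close> is about to rise above this height, and follow \<open>L\<close> from there. An element whose
  removal keeps the path below the shortened \<open>U\<close> must occur up to \<open>u\<close>, and one whose removal keeps it
  above the shortened \<open>L\<close> must occur after the east stretch, so this basis contains no basis of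
  the smaller matroid.
\<close>

lemma quotient_step_height:
  assumes U: "U \<in> ksubsets n (Suc k)" and L: "L \<in> ksubsets n (Suc k)" and UL: "gale_le U L"
    and u: "u \<in> U" and l: "l \<in> L"
    and Q: "matroid_quotient {1..n} (lpm n k (U - {u}) (L - {l})) (lpm n (Suc k) U L)"
  shows "prefix_count L l \<le> prefix_count U u"
proof (rule ccontr)
  assume "\<not> prefix_count L l \<le> prefix_count U u"
  then have viol: "prefix_count U u < prefix_count L l" by simp
  note U' = ksubsets_remove[OF U u] and L' = ksubsets_remove[OF L l]
  note fU = ksubsetsD[OF U] and fL = ksubsetsD[OF L]
  have ul: "prefix_count L j \<le> prefix_count U j" for j
    using UL gale_le_iff_card_Int[OF fU(1) fL(1)] by blast
  \<comment> \<open>The first step of \<open>L\<close> that ends above the step \<open>u\<close> of \<open>U\<close>; the path turns from east to \<open>L\<close>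
    just before it, at \<open>w = v - 1\<close>.\<close>
  define v where "v = (LEAST j. prefix_count U u < prefix_count L j)"
  have v: "prefix_count U u < prefix_count L v" unfolding v_def using viol by (rule LeastI)
  have vmin: "prefix_count L j \<le> prefix_count U u" if "j < v" for j
    using not_less_Least[of j "\<lambda>j. prefix_count U u < prefix_count L j"] that
    unfolding v_def by simp
  have vl: "v \<le> l" unfolding v_def using viol by (rule Least_le)
  have uv: "u < v"
  proof (rule ccontr)
    assume "\<not> u < v"
    then have "prefix_count L v \<le> prefix_count L u" using fL by (intro prefix_count_mono) auto
    then show False using v ul[of u] by simp
  qed
  then obtain w where w: "v = Suc w" "u \<le> w" by (cases v) auto
  have Lw: "prefix_count L w = prefix_count U u"
    using vmin[of w] v by (auto simp: w(1) prefix_count_Suc split: if_splits)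
  define B where "B = (U \<inter> {..u}) \<union> (L \<inter> {w<..})"
  have finB: "finite B" using fU fL by (simp add: B_def)
  have low: "prefix_count B j = prefix_count U j" if "j \<le> u" for j
    using that w by (intro arg_cong[where f=card]) (auto simp: B_def)
  have mid: "prefix_count B j = prefix_count U u" if "u \<le> j" "j \<le> w" for j
    using that by (intro arg_cong[where f=card]) (auto simp: B_def)
  have high: "prefix_count B j = prefix_count L j" if "w \<le> j" for j
  proof -
    have "B \<inter> {w<..j} = L \<inter> {w<..j}" using w by (auto simp: B_def)
    then show ?thesis
      using card_Int_atMost_split[OF finB that] card_Int_atMost_split[OF fL(1) that]
        mid[of w] w(2) Lw by simp
  qed
  have sub: "B \<subseteq> {1..n}" using fU fL by (auto simp: B_def)
  have "w \<le> n" using vl w fL l by auto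
  have "card B = Suc k"
  proof -
    have "B \<inter> {..n} = B" "L \<inter> {..n} = L" using sub fL by auto
    then show ?thesis using high[OF \<open>w \<le> n\<close>] fL by simp
  qed
  then have Bk: "B \<in> ksubsets n (Suc k)" using sub by (simp add: ksubsets_def)
  have B: "B \<in> lpm n (Suc k) U L"
    unfolding mem_lpm_iff[OF U L Bk]
  proof
    fix j
    consider "j \<le> u" | "u \<le> j" "j \<le> w" | "w \<le> j" by linarith
    then show "prefix_count L j \<le> prefix_count B j \<and> prefix_count B j \<le> prefix_count U j"
    proof cases
      case 2
      then show ?thesis
        using mid vmin[of j] w prefix_count_mono[OF fU(1), of u j] by auto
    qed (use low high ul in auto)
  qed
  obtain B' where B': "B' \<in> lpm n k (U - {u}) (L - {l})" "B' \<subseteq> B"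
    using quotient_basis_below[OF Q B] by blast
  have B'k: "B' \<in> ksubsets n k" using B' by (simp add: lpm_def)
  obtain b where b: "b \<in> B" "B' = B - {b}"
    using ksubset_subset_remove[OF Bk B'k B'(2)] by blast
  note rB = prefix_count_remove[OF finB b(1)] and rU = prefix_count_remove[OF fU(1) u]
    and rL = prefix_count_remove[OF fL(1) l]
  have bnd': "prefix_count (L - {l}) j \<le> prefix_count (B - {b}) j"
    "prefix_count (B - {b}) j \<le> prefix_count (U - {u}) j" for j
    using B'(1) mem_lpm_iff[OF U' L' B'k] b(2) by auto
  have "b \<le> u" using rB[of u] rU[of u] bnd'(2)[of u] low[of u] by (auto split: if_splits)
  moreover have "w < b"
    using rB[of w] rL[of w] bnd'(1)[of w] high[of w] vl w by (auto split: if_splits)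
  ultimately show False using w by simp
qed

text \<open>
  If the step \<open>u\<close> of \<open>U\<close> is farther east than the step \<open>l\<close> of \<open>L\<close>, follow \<open>L\<close> to the end of \<open>l\<close>, go
  north to \<open>U\<close>, and follow \<open>U\<close> from there; let \<open>p\<close> be the first east step on this last part. The
  path touches \<open>L\<close> at \<open>l\<close> and \<open>U\<close> at \<open>p\<close>, so neither \<open>l\<close> nor \<open>u\<close> can be exchanged for \<open>p\<close>. But
  removing an element \<open>b < p\<close> detaches the path from the shortened \<open>U\<close> on \<open>{p..<u}\<close>, so that \<open>u\<close>
  becomes exchangeable, and removing \<open>b > p\<close> detaches it from the shortened \<open>L\<close> on \<open>{l..<p}\<close>, so that
  \<open>l\<close> does.
\<close>

lemma quotient_step_width:
  assumes U: "U \<in> ksubsets n (Suc k)" and L: "L \<in> ksubsets n (Suc k)" and UL: "gale_le U L"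
    and u: "u \<in> U" and l: "l \<in> L"
    and Q: "matroid_quotient {1..n} (lpm n k (U - {u}) (L - {l})) (lpm n (Suc k) U L)"
  shows "u + prefix_count L l \<le> l + prefix_count U u"
proof (rule ccontr)
  assume "\<not> u + prefix_count L l \<le> l + prefix_count U u"
  then have viol: "l + prefix_count U u < u + prefix_count L l" by simp
  note U' = ksubsets_remove[OF U u] and L' = ksubsets_remove[OF L l]
  note fU = ksubsetsD[OF U] and fL = ksubsetsD[OF L]
  have ul: "prefix_count L j \<le> prefix_count U j" for j
    using UL gale_le_iff_card_Int[OF fU(1) fL(1)] by blast
  \<comment> \<open>The first step of \<open>U\<close> that ends farther east than the step \<open>l\<close> of \<open>L\<close>.\<close>
  define p where "p = (LEAST j. l + prefix_count U j < j + prefix_count L l)"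
  have p: "l + prefix_count U p < p + prefix_count L l"
    unfolding p_def using viol
    by (rule LeastI[where P = "\<lambda>j. l + prefix_count U j < j + prefix_count L l"])
  have pmin: "j + prefix_count L l \<le> l + prefix_count U j" if "j < p" for j
    using not_less_Least[of j "\<lambda>j. l + prefix_count U j < j + prefix_count L l"] that
    unfolding p_def by simp
  have pu: "p \<le> u" unfolding p_def using viol
    by (rule Least_le[where P = "\<lambda>j. l + prefix_count U j < j + prefix_count L l"])
  have lp: "l < p"
  proof (rule ccontr)
    assume "\<not> l < p"
    then have "p \<le> l" by simp
    have "prefix_count L l \<le> prefix_count L p + (l - p)"
      using \<open>p \<le> l\<close> by (rule prefix_count_diff_le)
    then show False using p ul[of p] \<open>p \<le> l\<close> by linarith
  qed
  then obtain w where w: "p = Suc w" "l \<le> w" by (cases p) auto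
  have pU: "p \<notin> U" and Up: "Suc l + prefix_count U p = p + prefix_count L l"
    using pmin[of w] p by (auto simp: w(1) prefix_count_Suc split: if_splits)
  have pu: "p < u" using pu pU u by (cases "p = u") auto
  define B where "B = (L \<inter> {..l}) \<union> {l<..<p} \<union> (U \<inter> {p<..})"
  have finB: "finite B" using fU fL by (simp add: B_def)
  have low: "prefix_count B j = prefix_count L j" if "j \<le> l" for j
    using that lp by (intro arg_cong[where f=card]) (auto simp: B_def)
  have mid: "prefix_count B j + l = prefix_count L l + j" if "l \<le> j" "j < p" for j
  proof -
    have "B \<inter> {l<..j} = {l<..j}" using that by (auto simp: B_def)
    then show ?thesis using card_Int_atMost_split[OF finB that(1)] low[of l] that by simp
  qed
  have "p \<notin> B" using lp by (auto simp: B_def)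
  then have Bp: "prefix_count B p = prefix_count U p"
    using mid[of w] w Up by (auto simp: prefix_count_Suc)
  have high: "prefix_count B j = prefix_count U j" if "p \<le> j" for j
  proof -
    have "B \<inter> {p<..j} = U \<inter> {p<..j}" using lp by (auto simp: B_def)
    then show ?thesis
      using card_Int_atMost_split[OF finB that] card_Int_atMost_split[OF fU(1) that] Bp by simp
  qed
  have "u \<le> n" using fU u by auto
  then have sub: "B \<subseteq> {1..n}" using fU fL pu by (auto simp: B_def)
  have "card B = Suc k"
  proof -
    have "B \<inter> {..n} = B" "U \<inter> {..n} = U" using sub fU by auto
    moreover have "p \<le> n" using pu \<open>u \<le> n\<close> by simp
    ultimately show ?thesis using high[of n] fU by simp
  qed
  then have Bk: "B \<in> ksubsets n (Suc k)" using sub by (simp add: ksubsets_def)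
  have B: "B \<in> lpm n (Suc k) U L"
    unfolding mem_lpm_iff[OF U L Bk]
  proof
    fix j
    consider "j \<le> l" | "l \<le> j" "j < p" | "p \<le> j" by linarith
    then show "prefix_count L j \<le> prefix_count B j \<and> prefix_count B j \<le> prefix_count U j"
    proof cases
      case 2
      then show ?thesis
        using mid[of j] pmin[of j] prefix_count_diff_le[of l j L] by linarith
    qed (use low high ul in auto)
  qed
  have pE: "p \<in> {1..n} - B" using \<open>p \<notin> B\<close> pu \<open>u \<le> n\<close> lp by auto
  have "\<exists>B'\<in>lpm n k (U - {u}) (L - {l}). B' \<subseteq> B \<and>
      (\<forall>q\<in>B'. (B' \<union> {p}) - {q} \<in> lpm n k (U - {u}) (L - {l}) \<longrightarrow>
        (B \<union> {p}) - {q} \<in> lpm n (Suc k) U L)"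
    using Q B pE unfolding matroid_quotient_def by simp
  then obtain B' where B': "B' \<in> lpm n k (U - {u}) (L - {l})" "B' \<subseteq> B"
    and ex: "\<And>q. q \<in> B' \<Longrightarrow> (B' \<union> {p}) - {q} \<in> lpm n k (U - {u}) (L - {l}) \<Longrightarrow>
      (B \<union> {p}) - {q} \<in> lpm n (Suc k) U L"
    by blast
  have B'k: "B' \<in> ksubsets n k" using B' by (simp add: lpm_def)
  obtain b where b: "b \<in> B" "B' = B - {b}"
    using ksubset_subset_remove[OF Bk B'k B'(2)] by blast
  note rB = prefix_count_remove[OF finB b(1)] and rU = prefix_count_remove[OF fU(1) u]
    and rL = prefix_count_remove[OF fL(1) l]
  have pE': "p \<in> {1..n} - B'" using pE B'(2) by auto
  have bnd: "prefix_count L j \<le> prefix_count B j" for j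
    using B mem_lpm_iff[OF U L Bk] by auto
  have "b \<noteq> p" using b \<open>p \<notin> B\<close> by auto
  then consider "b < p" | "p < b" by linarith
  then show False
  proof cases
    case 1
    have uB: "u \<in> B" using u pu by (auto simp: B_def)
    then have uB': "u \<in> B'" using b 1 pu by auto
    have "(B' \<union> {p}) - {u} \<in> lpm n k (U - {u}) (L - {l})"
      unfolding lpm_swap_iff[OF U' L' B'(1) pE' uB']
    proof (intro conjI allI impI)
      fix j assume "p \<le> j \<and> j < u"
      then show "prefix_count B' j < prefix_count (U - {u}) j"
        using rB[of j] rU[of j] high[of j] 1 b(2) by (auto split: if_splits)
    qed (use pu in auto)
    then have "(B \<union> {p}) - {u} \<in> lpm n (Suc k) U L" using uB' by (intro ex)
    then have "prefix_count B p < prefix_count U p"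
      unfolding lpm_swap_iff[OF U L B pE uB] using pu by blast
    then show False using Bp by simp
  next
    case 2
    have lB: "l \<in> B" using l by (auto simp: B_def)
    then have lB': "l \<in> B'" using b 2 lp by auto
    have "(B' \<union> {p}) - {l} \<in> lpm n k (U - {u}) (L - {l})"
      unfolding lpm_swap_iff[OF U' L' B'(1) pE' lB']
    proof (intro conjI allI impI)
      fix j assume "l \<le> j \<and> j < p"
      then show "prefix_count (L - {l}) j < prefix_count B' j"
        using rB[of j] rL[of j] bnd[of j] 2 b(2) by (auto split: if_splits)
    qed (use lp in auto)
    then have "(B \<union> {p}) - {l} \<in> lpm n (Suc k) U L" using lB' by (intro ex)
    then have "prefix_count L l < prefix_count B l"
      unfolding lpm_swap_iff[OF U L B pE lB] using lp by blast
    then show False using low[of l] by simp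
  qed
qed

section \<open>The constituents of the flag matroid of an interval\<close>

lemma gale_le_antisym:
  assumes "finite A" "finite B" "gale_le A B" "gale_le B A"
  shows "A = B"
proof -
  have "sorted_list_of_set A = sorted_list_of_set B"
    using assms(3,4) unfolding gale_le_def by (intro nth_equalityI)
      (auto simp: list_all2_conv_all_nth intro: antisym)
  then show ?thesis using assms(1,2) sorted_list_of_set_inject by blast
qed

lemma gale_le_refl: "finite A \<Longrightarrow> gale_le A A"
  by (simp add: gale_le_iff_card_Int)

lemma uniform_flagsD:
  assumes "B \<in> uniform_flags n"
  shows "i \<le> n \<Longrightarrow> B i \<in> ksubsets n i" "i < n \<Longrightarrow> B i \<subseteq> B (Suc i)"
  using assms by (auto simp: uniform_flags_def flags_of_bases_def uniform_matroid_def PiE_iff)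

lemma flag_gale_interval_eq_lpm_flags:
  "flag_gale_interval n B B' = flags_of_bases n (\<lambda>i. lpm n i (B i) (B' i))"
  by (auto simp: flag_gale_interval_def flag_gale_le_def uniform_flags_def flags_of_bases_def
      uniform_matroid_def lpm_def PiE_iff)

text \<open>
  \<open>B\<close> and \<open>B'\<close> are themselves flags of bases, which fixes the ranks and places \<open>B i\<close>, \<open>B' i\<close> between
  the boundary paths of \<open>M i\<close>. The boundary paths of \<open>M i\<close> are bases, hence members of flags in the
  interval, and so lie between \<open>B i\<close> and \<open>B' i\<close>.
\<close>

lemma interval_lpfm_constituents:
  assumes B: "B \<in> uniform_flags n" and B': "B' \<in> uniform_flags n" and le: "flag_gale_le n B B'"
    and M: "is_lpfm n M" and eq: "flag_gale_interval n B B' = flags_of_bases n M"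
    and i: "i \<le> n"
  shows "M i = lpm n i (B i) (B' i)"
proof -
  have fin: "finite (B j)" "finite (B' j)" if "j \<le> n" for j
    using uniform_flagsD(1)[OF B that] uniform_flagsD(1)[OF B' that] ksubsetsD(1) by blast+
  have "B \<in> flag_gale_interval n B B'" "B' \<in> flag_gale_interval n B B'"
    using B B' le fin by (auto simp: flag_gale_interval_def flag_gale_le_def gale_le_refl)
  then have mem: "B j \<in> M j" "B' j \<in> M j" if "j \<le> n" for j
    using that unfolding eq by (auto simp: flags_of_bases_def PiE_iff)
  have form: "\<exists>P\<in>ksubsets n j. \<exists>R\<in>ksubsets n j. gale_le P R \<and> M j = lpm n j P R" if j: "j \<le> n" for j
  proof -
    obtain k P R where PR: "P \<in> ksubsets n k" "R \<in> ksubsets n k" "gale_le P R" "M j = lpm n k P R"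
    proof -
      have "is_lpm n (M j)" using M j by (simp add: is_lpfm_def)
      then show thesis using that unfolding is_lpm_def by blast
    qed
    have "card (B j) = k" using mem(1)[OF j] PR(4) ksubsetsD(3) by (auto simp: lpm_def)
    then have "k = j" using uniform_flagsD(1)[OF B j] ksubsetsD(3) by blast
    then show ?thesis using PR by blast
  qed
  have rank: "M j \<subseteq> ksubsets n j" if "j \<le> n" for j using form[OF that] by (auto simp: lpm_def)
  have Q: "matroid_quotient {1..n} (M j) (M (Suc j))" if "j < n" for j
    using M that by (simp add: is_lpfm_def)
  obtain P R where P: "P \<in> ksubsets n i" and R: "R \<in> ksubsets n i" and PR: "gale_le P R"
    and Mi: "M i = lpm n i P R" using form[OF i] by blast
  have finPR: "finite P" "finite R" using P R ksubsetsD(1) by blast+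
  have bounds: "gale_le (B i) A \<and> gale_le A (B' i)" if A: "A \<in> M i" for A
  proof -
    obtain C where C: "C \<in> flags_of_bases n M" "C i = A"
      using basis_in_flag[of n M i A] rank Q i A by blast
    then show ?thesis
      using i unfolding eq[symmetric] by (auto simp: flag_gale_interval_def flag_gale_le_def)
  qed
  have "P \<in> M i" "R \<in> M i" using P R PR finPR by (auto simp: Mi lpm_def gale_le_refl)
  then have "gale_le (B i) P" "gale_le R (B' i)" using bounds by blast+
  moreover have "gale_le P (B i)" "gale_le (B' i) R" using mem[OF i] by (auto simp: Mi lpm_def)
  ultimately have "P = B i" "R = B' i" using gale_le_antisym finPR fin[OF i] by blast+
  then show ?thesis using Mi by simp
qed

lemma flag_interval_lpfm_iff_quotients:
  assumes B: "B \<in> uniform_flags n" and B': "B' \<in> uniform_flags n" and le: "flag_gale_le n B B'"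
  shows "(\<exists>M. is_lpfm n M \<and> flag_gale_interval n B B' = flags_of_bases n M) \<longleftrightarrow>
    (\<forall>i<n. matroid_quotient {1..n} (lpm n i (B i) (B' i)) (lpm n (Suc i) (B (Suc i)) (B' (Suc i))))"
    (is "?lhs \<longleftrightarrow> ?rhs")
proof
  assume ?lhs
  then obtain M where M: "is_lpfm n M" "flag_gale_interval n B B' = flags_of_bases n M" by blast
  note eq = interval_lpfm_constituents[OF B B' le M]
  show ?rhs
  proof (intro allI impI)
    fix i assume "i < n"
    then show "matroid_quotient {1..n} (lpm n i (B i) (B' i)) (lpm n (Suc i) (B (Suc i)) (B' (Suc i)))"
      using M(1) eq[of i] eq[of "Suc i"] unfolding is_lpfm_def by (metis Suc_leI less_imp_le)
  qed
next
  assume rhs: ?rhs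
  let ?M = "\<lambda>i. lpm n i (B i) (B' i)"
  have lpm: "is_lpm n (?M i)" if "i \<le> n" for i
    using uniform_flagsD(1)[OF B that] uniform_flagsD(1)[OF B' that] le that
    by (intro mem_is_lpm) (auto simp: flag_gale_le_def)
  have "inj_on ?M {0..n}"
  proof (rule inj_onI)
    fix i j assume i: "i \<in> {0..n}" and eq: "?M i = ?M j"
    obtain A where "A \<in> ?M i"
      using is_lpm_imp_matroid_bases[OF lpm[of i]] i unfolding matroid_bases_def by auto
    then have "A \<in> ksubsets n i" "A \<in> ksubsets n j" using eq by (auto simp: lpm_def)
    then show "i = j" using ksubsetsD(3) by blast
  qed
  then have "is_lpfm n ?M" using lpm rhs by (auto simp: is_lpfm_def)
  then show ?lhs using flag_gale_interval_eq_lpm_flags by blast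
qed

section \<open>From lattice paths to permutations\<close>

text \<open>
  The standardized value of the element added last is the height of its step, and its distance to
  the element itself is the number of preceding east steps. Comparing with \<open>0\<close> in the maximum
  is therefore the condition on heights, and comparing with the difference of the elements is the
  condition on east steps.
\<close>

lemma quotient_step_iff_standardization:
  assumes B: "B \<in> uniform_flags n" and B': "B' \<in> uniform_flags n" and le: "flag_gale_le n B B'"
    and i: "i < n"
  defines "\<pi> \<equiv> gale_perm n B" and "\<pi>' \<equiv> gale_perm n B'"
  shows "matroid_quotient {1..n} (lpm n i (B i) (B' i)) (lpm n (Suc i) (B (Suc i)) (B' (Suc i))) \<longleftrightarrow>
    max 0 (int (\<pi> (Suc i)) - int (\<pi>' (Suc i)))
      \<le> int (standardization (\<pi> ` {1..Suc i}) (\<pi> (Suc i)))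
        - int (standardization (\<pi>' ` {1..Suc i}) (\<pi>' (Suc i)))"
    (is "?Q \<longleftrightarrow> ?ineq")
proof -
  let ?U = "B (Suc i)" and ?L = "B' (Suc i)" and ?u = "\<pi> (Suc i)" and ?l = "\<pi>' (Suc i)"
  have st: "standardization (gale_perm n D ` {1..Suc i}) (gale_perm n D (Suc i))
      = prefix_count (D (Suc i)) (gale_perm n D (Suc i))"
    and step: "gale_perm n D (Suc i) \<in> D (Suc i)" "D i = D (Suc i) - {gale_perm n D (Suc i)}"
    and ks: "D (Suc i) \<in> ksubsets n (Suc i)"
    if D: "D \<in> uniform_flags n" for D
  proof -
    have sing: "D (Suc i) - D i = {gale_perm n D (Suc i)}"
      using gale_perm_singleton[OF D, of "Suc i"] i by simp
    then show mem: "gale_perm n D (Suc i) \<in> D (Suc i)" by blast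
    show "D i = D (Suc i) - {gale_perm n D (Suc i)}"
      using sing uniform_flagsD(2)[OF D i] by auto
    show ks: "D (Suc i) \<in> ksubsets n (Suc i)" using uniform_flagsD(1)[OF D] i by simp
    have "{y \<in> D (Suc i). y \<le> gale_perm n D (Suc i)} = D (Suc i) \<inter> {..gale_perm n D (Suc i)}"
      by auto
    then show "standardization (gale_perm n D ` {1..Suc i}) (gale_perm n D (Suc i))
      = prefix_count (D (Suc i)) (gale_perm n D (Suc i))"
      using gale_perm_image[OF D, of "Suc i"] standardization_eq_card[OF ksubsetsD(1)[OF ks] mem] i
      by simp
  qed
  have UL: "gale_le ?U ?L" "gale_le (B i) (B' i)" using le i by (auto simp: flag_gale_le_def)
  note U = ks[OF B] and L = ks[OF B']
    and u = step(1)[OF B, folded \<pi>_def] and l = step(1)[OF B', folded \<pi>'_def]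
    and Bi = step(2)[OF B, folded \<pi>_def] and B'i = step(2)[OF B', folded \<pi>'_def]
  have "?ineq \<longleftrightarrow> prefix_count ?L ?l \<le> prefix_count ?U ?u \<and>
      ?u + prefix_count ?L ?l \<le> ?l + prefix_count ?U ?u"
    unfolding \<pi>_def \<pi>'_def st[OF B] st[OF B'] by linarith
  also have "\<dots> \<longleftrightarrow> ?Q"
    using quotient_step_sufficient[OF U L UL(1) u l] UL(2) quotient_step_height[OF U L UL(1) u l]
      quotient_step_width[OF U L UL(1) u l]
    unfolding Bi[symmetric] B'i[symmetric] by blast
  finally show ?thesis by blast
qed

lemma inv_bruhat_perm:
  assumes B: "B \<in> uniform_flags n" and k: "k \<in> {1..n}"
  shows "inv (bruhat_perm n B) (n - k + 1) = gale_perm n B k"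
proof -
  let ?f = "\<lambda>i. if i \<in> {1..n} then gale_perm n B (n - i + 1) else i"
  have "bij_betw (\<lambda>i. n - i + 1) {1..n} {1..n}"
    by (rule bij_betw_byWitness[where f' = "\<lambda>i. n - i + 1"]) auto
  then have "bij_betw (gale_perm n B \<circ> (\<lambda>i. n - i + 1)) {1..n} {1..n}"
    using permutes_imp_bij[OF gale_perm_permutes[OF B]] by (rule bij_betw_trans)
  moreover have "bij_betw ?f {1..n} {1..n} =
      bij_betw (gale_perm n B \<circ> (\<lambda>i. n - i + 1)) {1..n} {1..n}"
    by (rule bij_betw_cong) simp
  ultimately have "?f permutes {1..n}" by (intro bij_imp_permutes) auto
  then have "bij ?f" by (rule permutes_bij)
  then have "inv (bruhat_perm n B) = ?f" unfolding bruhat_perm_def by (rule inv_inv_eq)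
  moreover have "n - k + 1 \<in> {1..n}" "n - (n - k + 1) + 1 = k" using k by auto
  ultimately show ?thesis by simp
qed

theorem theorem34:
  fixes n :: nat and \<BB> \<BB>' :: "nat \<Rightarrow> nat set" and \<pi> \<pi>' \<tau> \<tau>' a a' :: "nat \<Rightarrow> nat"
  assumes "\<BB> \<in> uniform_flags n" and "\<BB>' \<in> uniform_flags n"
    and "flag_gale_le n \<BB> \<BB>'"
    and "\<pi> = gale_perm n \<BB>" and "\<pi>' = gale_perm n \<BB>'"
    and "\<tau> = bruhat_perm n \<BB>" and "\<tau>' = bruhat_perm n \<BB>'"
    and "\<And>k. a k = inv \<tau> (n - k + 1)" and "\<And>k. a' k = inv \<tau>' (n - k + 1)"
  shows "((\<exists>M. is_lpfm n M \<and> flag_gale_interval n \<BB> \<BB>' = flags_of_bases n M)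
          \<longleftrightarrow> (\<forall>k\<in>{1..n}. max 0 (int (\<pi> k) - int (\<pi>' k))
                 \<le> int (standardization (\<pi> ` {1..k}) (\<pi> k))
                   - int (standardization (\<pi>' ` {1..k}) (\<pi>' k))))
       \<and> ((\<forall>k\<in>{1..n}. max 0 (int (\<pi> k) - int (\<pi>' k))
                 \<le> int (standardization (\<pi> ` {1..k}) (\<pi> k))
                   - int (standardization (\<pi>' ` {1..k}) (\<pi>' k)))
          \<longleftrightarrow> (\<forall>k\<in>{1..n}. max 0 (int (a k) - int (a' k))
                 \<le> int (standardization (a ` {1..k}) (a k))
                   - int (standardization (a' ` {1..k}) (a' k))))"
proof -
  have "(\<forall>i<n. matroid_quotient {1..n} (lpm n i (\<BB> i) (\<BB>' i))
          (lpm n (Suc i) (\<BB> (Suc i)) (\<BB>' (Suc i)))) \<longleftrightarrow>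
      (\<forall>k\<in>{1..n}. max 0 (int (\<pi> k) - int (\<pi>' k))
        \<le> int (standardization (\<pi> ` {1..k}) (\<pi> k))
          - int (standardization (\<pi>' ` {1..k}) (\<pi>' k)))" (is "_ \<longleftrightarrow> (\<forall>k\<in>_. ?ii k)")
  proof -
    have "(\<forall>k\<in>{1..n}. ?ii k) \<longleftrightarrow> (\<forall>i\<in>{..<n}. ?ii (Suc i))"
      unfolding image_Suc_lessThan[symmetric] by (rule ball_simps)
    then show ?thesis
      using quotient_step_iff_standardization[OF assms(1-3), folded assms(4,5)] by auto
  qed
  moreover have a: "a k = \<pi> k" "a' k = \<pi>' k" if "k \<in> {1..n}" for k
    using inv_bruhat_perm that assms by metis+
  have "a ` {1..k} = \<pi> ` {1..k}" "a' ` {1..k} = \<pi>' ` {1..k}" if "k \<in> {1..n}" for k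
    using that a by (auto intro!: image_cong)
  ultimately show ?thesis
    using flag_interval_lpfm_iff_quotients[OF assms(1-3)] a by simp
qed

end
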